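(* Let $X\in M_2(\mathbb{N}_0)^\bullet$ be a doubly-balanced matrix with relatively prime adjacent entries. If $|\det(X)|\in\{p,2p,4p\}$ for some prime $p$, then $X$ is an atom of $M_2(\mathbb{N}_0)^\bullet$.
   Context: $M_2(\mathbb{N}_0)^\bullet$ is the semigroup, under matrix multiplication, of $2\times 2$ matrices with non-negative integer entries and non-zero determinant. Its only units are $I=\begin{pmatrix}1&0\\0&1\end{pmatrix}$ and $J=\begin{pmatrix}0&1\\1&0\end{pmatrix}$. An atom is a non-unit $X\in M_2(\mathbb{N}_0)^\bullet$ such that whenever $X=AB$ with $A,B\in M_2(\mathbb{N}_0)^\bullet$, at least one of $A,B$ is a unit. A row of a $2\times2$ matrix is dominant if both of its entries are greater than or equal to the corresponding entries of the other row; a column is dominant if both of its entries are greater than or equal to the corresponding entries of the other column. A matrix is row-balanced if neither row is dominant, column-balanced if neither column is dominant, and doubly-balanced if it is both row- and column-balanced. A matrix $\begin{pmatrix}w&x\\ y&z\end{pmatrix}$ has relatively prime adjacent entries if the two entries of each row are relatively prime and the two entries of each column are relatively prime; equivalently, $\gcd(wz,xy)=1$. *)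

theory Defs
  imports "HOL-Analysis.Analysis" "HOL-Algebra.Group"
begin

text \<open>The library determinant needs a commutative ring of entries, so it is taken over the integers.\<close>

definition idet :: "nat^2^2 \<Rightarrow> int" where
  "idet X = det (map_matrix int X)"

definition M2 :: "(nat^2^2) monoid" where
  "M2 = \<lparr>carrier = {X. idet X \<noteq> 0}, mult = (**), one = mat 1\<rparr>"

text \<open>The predicate \<^const>\<open>irreducible\<close> of HOL-Algebra is formulated through one-sided divisibility and is
  geared towards commutative monoids; here the non-commutative notion is needed.\<close>

definition atom :: "('a, 'b) monoid_scheme \<Rightarrow> 'a \<Rightarrow> bool" where
  "atom G x \<longleftrightarrow> x \<in> carrier G \<and> x \<notin> Units G \<and>
    (\<forall>a \<in> carrier G. \<forall>b \<in> carrier G. x = a \<otimes>\<^bsub>G\<^esub> b \<longrightarrow> a \<in> Units G \<or> b \<in> Units G)"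

definition dominant_row :: "nat^2^2 \<Rightarrow> 2 \<Rightarrow> bool" where
  "dominant_row X i \<longleftrightarrow> (\<forall>k. k \<noteq> i \<longrightarrow> (\<forall>j. X $ k $ j \<le> X $ i $ j))"

definition dominant_column :: "nat^2^2 \<Rightarrow> 2 \<Rightarrow> bool" where
  "dominant_column X j \<longleftrightarrow> (\<forall>k. k \<noteq> j \<longrightarrow> (\<forall>i. X $ i $ k \<le> X $ i $ j))"

definition row_balanced :: "nat^2^2 \<Rightarrow> bool" where
  "row_balanced X \<longleftrightarrow> (\<forall>i. \<not> dominant_row X i)"

definition column_balanced :: "nat^2^2 \<Rightarrow> bool" where
  "column_balanced X \<longleftrightarrow> (\<forall>j. \<not> dominant_column X j)"

definition doubly_balanced :: "nat^2^2 \<Rightarrow> bool" where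
  "doubly_balanced X \<longleftrightarrow> row_balanced X \<and> column_balanced X"

definition coprime_adjacent :: "nat^2^2 \<Rightarrow> bool" where
  "coprime_adjacent X \<longleftrightarrow>
    (\<forall>i. coprime (X $ i $ 1) (X $ i $ 2)) \<and> (\<forall>j. coprime (X $ 1 $ j) (X $ 2 $ j))"

lemma idet_2: "idet X = int (X$1$1) * int (X$2$2) - int (X$1$2) * int (X$2$1)"
  by (simp add: idet_def det_2 map_matrix_def)

lemma idet_mult: "idet (X ** Y) = idet X * idet Y"
  by (simp add: idet_2 matrix_matrix_mult_def sum_2 algebra_simps)

lemma idet_one: "idet (mat 1) = 1"
  by (simp add: idet_2 mat_def)

lemma monoid_M2: "monoid M2"
  by (rule monoidI)
    (auto simp: M2_def idet_mult idet_one matrix_mul_assoc matrix_mul_lid matrix_mul_rid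
      simp del: One_nat_def)

lemma Units_M2: "Units M2 = {mat 1, vector [vector [0, 1], vector [1, 0]]}"
proof -
  let ?J = "vector [vector [0, 1], vector [1, 0]] :: nat^2^2"
  have JJ: "?J ** ?J = mat 1"
    by (simp add: vec_eq_iff forall_2 matrix_matrix_mult_def sum_2 mat_def vector_2)
  have detJ: "idet ?J = -1"
    by (simp add: idet_2 vector_2)
  have "X = mat 1 \<or> X = ?J" if XY: "X ** Y = mat 1" and YX: "Y ** X = mat 1" for X Y :: "nat^2^2"
  proof -
    have 1: "X$1$1 * Y$1$1 + X$1$2 * Y$2$1 = 1" "X$1$1 * Y$1$2 + X$1$2 * Y$2$2 = 0"
      "X$2$1 * Y$1$1 + X$2$2 * Y$2$1 = 0" "X$2$1 * Y$1$2 + X$2$2 * Y$2$2 = 1"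
      using XY by (simp_all add: vec_eq_iff forall_2 matrix_matrix_mult_def sum_2 mat_def)
    have "X$1$1 = 1 \<and> X$1$2 = 0 \<and> X$2$1 = 0 \<and> X$2$2 = 1 \<or> X$1$1 = 0 \<and> X$1$2 = 1 \<and> X$2$1 = 1 \<and> X$2$2 = 0"
      using 1 by (auto simp: add_is_1)
    then show ?thesis
      by (simp add: vec_eq_iff forall_2 mat_def vector_2)
  qed
  then have "Units M2 \<subseteq> {mat 1, ?J}"
    by (auto simp: Units_def M2_def simp del: One_nat_def)
  moreover have "mat 1 \<in> Units M2"
    using monoid.Units_one_closed[OF monoid_M2] by (simp add: M2_def del: One_nat_def)
  moreover have "?J \<in> Units M2"
    unfolding Units_def M2_def using JJ detJ
    by (auto simp del: One_nat_def intro!: exI[of _ ?J])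
  ultimately show ?thesis
    by blast
qed

end

theory Submission
  imports Defs
begin

text \<open>
  Suppose \<open>X = A ** B\<close>. The determinant is multiplicative and \<open>p\<close> divides one of the two factors
  \<open>idet A\<close>, \<open>idet B\<close>, so the other one is, up to sign, a divisor of \<open>4\<close>. As the hypotheses on
  \<open>X\<close> are invariant under transposition, which turns \<open>A ** B\<close> into
  \<open>transpose B ** transpose A\<close>, that other factor may be taken to be the left one, \<open>A\<close>.

  Each row of \<open>X\<close> is the corresponding row of \<open>A\<close> multiplied by \<open>B\<close>. Hence a dominant row of
  \<open>A\<close> would make a row of \<open>X\<close> dominant, and a common divisor of a row of \<open>A\<close> would divide a row
  of \<open>X\<close>: \<open>A\<close> is row-balanced with coprime rows. Now being row-balanced makes the determinant large
  compared with the entries: after exchanging the rows if need be, \<open>c < a\<close> and \<open>b < d\<close>, so that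
  \<open>a * d - b * c \<ge> (c + 1) * (b + 1) - b * c = b + c + 1\<close>.
  With determinant \<open>1\<close>, \<open>2\<close> or \<open>4\<close> only finitely many matrices remain, and among them the identity
  is the only one with coprime rows (\<open>balanced_small_det_identity\<close>). So \<open>A\<close> is a unit.
\<close>

text \<open>The bound \<open>b + c < a * d - b * c\<close> leaves the pairs \<open>(b, c)\<close> with \<open>b + c \<le> 3\<close>. If \<open>b * c = 0\<close>,
  some row has the form \<open>(n, 0)\<close> or \<open>(0, n)\<close>; coprimality forces \<open>n = 1\<close>, and then the strict
  inequalities leave only the identity. Otherwise \<open>b\<close> and \<open>c\<close> are \<open>1\<close> or \<open>2\<close>, and the only
  solutions have rows \<open>(3, 1), (2, 2)\<close> or \<open>(2, 2), (1, 3)\<close>, where \<open>(2, 2)\<close> is not coprime.\<close>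

lemma balanced_small_det_identity:
  fixes a b c d k :: nat
  assumes "c < a" "b < d" and det: "a * d = b * c + k" and k: "k \<in> {1, 2, 4}"
    and ab: "coprime a b" and cd: "coprime c d"
  shows "a = 1 \<and> b = 0 \<and> c = 0 \<and> d = 1"
proof -
  have "(c + 1) * (b + 1) \<le> a * d"
    using assms(1,2) by (intro mult_le_mono) auto
  then have bc: "b + c < k"
    using det by (simp add: algebra_simps)
  then have bc4: "b + c \<le> 3"
    using k by auto
  consider "b = 0" | "c = 0" | "b = 1" "c = 1" | "b = 1" "c = 2" | "b = 2" "c = 1"
    using bc4 by linarith
  then show ?thesis
  proof cases
    case 1
    then have "a = 1" using ab by simp
    then show ?thesis using 1 assms(1) cd by simp
  next
    case 2
    then have "d = 1" using cd by simp
    then show ?thesis using 2 assms(2) ab by simp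
  next
    case 3
    then have "k = 4" using bc k by auto
    then have "a * d = 5" using det 3 by simp
    moreover have "prime (5 :: nat)" by simp
    ultimately have "a = 1 \<or> d = 1" by (metis prime_product)
    then show ?thesis using 3 assms(1,2) by auto
  next
    case 4
    then have "k = 4" using bc k by auto
    then have ad: "a * d = 6" using det 4 by simp
    have "d \<le> 2"
      using mult_le_mono[of 3 a 3 d] ad assms(1) 4 by linarith
    then have "d = 2" using assms(2) 4 by linarith
    then show ?thesis using cd 4 by simp
  next
    case 5
    then have "k = 4" using bc k by auto
    then have ad: "a * d = 6" using det 5 by simp
    have "a \<le> 2"
      using mult_le_mono[of 3 a 3 d] ad assms(2) 5 by linarith
    then have "a = 2" using assms(1) 5 by linarith
    then show ?thesis using ab 5 by simp
  qed
qed

lemma row_balanced_2: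
  "row_balanced A \<longleftrightarrow>
    A$2$1 < A$1$1 \<and> A$1$2 < A$2$2 \<or> A$1$1 < A$2$1 \<and> A$2$2 < A$1$2"
  unfolding row_balanced_def dominant_row_def forall_2
  by (simp del: One_nat_def) linarith

lemma Units_if_row_balanced_small_det:
  assumes "row_balanced A" and rows: "\<And>i. coprime (A$i$1) (A$i$2)"
    and "\<bar>idet A\<bar> \<in> {1, 2, 4}"
  shows "A \<in> Units M2"
proof -
  define k where "k = nat \<bar>idet A\<bar>"
  have k: "k \<in> {1, 2, 4}" "int k = \<bar>idet A\<bar>"
    using assms(3) by (auto simp: k_def)
  consider "A$2$1 < A$1$1" "A$1$2 < A$2$2" | "A$1$1 < A$2$1" "A$2$2 < A$1$2"
    using assms(1) row_balanced_2 by blast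
  then show ?thesis
  proof cases
    case 1
    then have "A$1$2 * A$2$1 \<le> A$2$2 * A$1$1"
      by (intro mult_le_mono) auto
    then have "int (A$1$2 * A$2$1) \<le> int (A$2$2 * A$1$1)"
      by (simp only: of_nat_le_iff)
    then have "int (A$1$1 * A$2$2) = int (A$1$2 * A$2$1 + k)"
      using k(2) by (simp add: idet_2 mult.commute)
    then have "A$1$1 * A$2$2 = A$1$2 * A$2$1 + k"
      by (simp only: of_nat_eq_iff)
    from balanced_small_det_identity[OF 1 this k(1) rows rows]
    have "A = mat 1"
      by (simp add: vec_eq_iff forall_2 mat_def)
    then show ?thesis by (simp add: Units_M2)
  next
    case 2
    then have "A$1$1 * A$2$2 \<le> A$2$1 * A$1$2"
      by (intro mult_le_mono) auto
    then have "int (A$1$1 * A$2$2) \<le> int (A$2$1 * A$1$2)"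
      by (simp only: of_nat_le_iff)
    then have "int (A$2$1 * A$1$2) = int (A$2$2 * A$1$1 + k)"
      using k(2) by (simp add: idet_2 mult.commute)
    then have "A$2$1 * A$1$2 = A$2$2 * A$1$1 + k"
      by (simp only: of_nat_eq_iff)
    from balanced_small_det_identity[OF 2 this k(1) rows rows]
    have "A = vector [vector [0, 1], vector [1, 0]]"
      by (simp add: vec_eq_iff forall_2 vector_2)
    then show ?thesis by (simp add: Units_M2)
  qed
qed

lemma dominant_row_mult:
  assumes "dominant_row A i"
  shows "dominant_row (A ** B) i"
  using assms unfolding dominant_row_def matrix_matrix_mult_def
  by (auto intro!: sum_mono mult_le_mono)

lemma row_balanced_left_factor: "row_balanced (A ** B) \<Longrightarrow> row_balanced A"
  using dominant_row_mult unfolding row_balanced_def by blast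

lemma coprime_row_left_factor:
  fixes A B :: "nat^2^2"
  assumes "coprime ((A ** B)$i$1) ((A ** B)$i$2)"
  shows "coprime (A$i$1) (A$i$2)"
proof (rule coprimeI)
  fix n assume "n dvd A$i$1" "n dvd A$i$2"
  then have "n dvd (A ** B)$i$j" for j
    by (simp add: matrix_matrix_mult_def sum_2)
  then show "is_unit n"
    using assms coprime_common_divisor by blast
qed

lemma Units_left_factor:
  assumes "row_balanced (A ** B)" "coprime_adjacent (A ** B)" "\<bar>idet A\<bar> \<in> {1, 2, 4}"
  shows "A \<in> Units M2"
  using assms row_balanced_left_factor coprime_row_left_factor Units_if_row_balanced_small_det
  unfolding coprime_adjacent_def by blast

lemma transpose_mult_nat: "transpose (A ** B) = transpose B ** transpose (A :: nat^2^2)"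
  by (simp add: vec_eq_iff transpose_def matrix_matrix_mult_def mult.commute)

lemma row_balanced_transpose: "row_balanced (transpose X) \<longleftrightarrow> column_balanced X"
  by (simp add: row_balanced_def column_balanced_def dominant_row_def dominant_column_def
      transpose_def)

lemma coprime_adjacent_transpose: "coprime_adjacent (transpose X) \<longleftrightarrow> coprime_adjacent X"
  by (auto simp: coprime_adjacent_def transpose_def)

lemma idet_transpose: "idet (transpose X) = idet X"
  by (simp add: idet_2 transpose_def mult.commute)

lemma transpose_Units_M2: "transpose X \<in> Units M2 \<longleftrightarrow> X \<in> Units M2"
  by (auto simp: Units_M2 vec_eq_iff forall_2 transpose_def mat_def vector_2)

lemma Units_right_factor:
  assumes "column_balanced (A ** B)" "coprime_adjacent (A ** B)" "\<bar>idet B\<bar> \<in> {1, 2, 4}"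
  shows "B \<in> Units M2"
  using Units_left_factor[of "transpose B" "transpose A"] assms
  by (simp only: transpose_mult_nat[symmetric] row_balanced_transpose
      coprime_adjacent_transpose idet_transpose transpose_Units_M2)

lemma cofactor_of_prime_small:
  fixes m n :: int
  assumes "prime p" and mn: "\<bar>m * n\<bar> \<in> {int p, 2 * int p, 4 * int p}" and "int p dvd m"
  shows "\<bar>n\<bar> \<in> {1, 2, 4}"
proof -
  obtain l where l: "m = int p * l"
    using assms(3) by blast
  have "p > 0" using assms(1) prime_gt_0_nat by blast
  moreover have "\<bar>m * n\<bar> = int p * \<bar>l * n\<bar>"
    by (simp add: l abs_mult)
  ultimately have "\<bar>l * n\<bar> \<in> {1, 2, 4}"
    using mn by auto
  then have "\<bar>l * n\<bar> dvd 4" by (auto simp del: abs_dvd_iff)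
  then have dvd: "\<bar>n\<bar> dvd 4"
    by (metis abs_dvd_iff dvd_mult_right)
  then have "\<bar>n\<bar> \<le> 4" by (intro zdvd_imp_le) auto
  moreover have "\<bar>n\<bar> \<noteq> 0" "\<bar>n\<bar> \<noteq> 3"
    using dvd by (auto simp del: abs_dvd_iff)
  ultimately show ?thesis by auto
qed

theorem theorem4p3:
  fixes X :: "nat^2^2" and p :: nat
  assumes "X \<in> carrier M2"
    and "doubly_balanced X"
    and "coprime_adjacent X"
    and "prime p"
    and "\<bar>idet X\<bar> \<in> {int p, 2 * int p, 4 * int p}"
  shows "atom M2 X"
  unfolding atom_def
proof (intro conjI ballI impI)
  show "X \<in> carrier M2" by fact
  \<comment> \<open>The units are doubly balanced with coprime rows and columns as well; only the size of the
    determinant excludes them.\<close>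
  have "\<bar>idet X\<bar> > 1"
    using assms(5) prime_gt_1_nat[OF assms(4)] by auto
  then show "X \<notin> Units M2"
    by (auto simp: Units_M2 idet_2 mat_def vector_2)
next
  fix A B assume "X = A \<otimes>\<^bsub>M2\<^esub> B"
  then have X: "X = A ** B" by (simp add: M2_def)
  then have det: "\<bar>idet A * idet B\<bar> \<in> {int p, 2 * int p, 4 * int p}"
    using assms(5) by (simp add: idet_mult)
  have bal: "row_balanced (A ** B)" "column_balanced (A ** B)"
    and cop: "coprime_adjacent (A ** B)"
    using assms(2,3) unfolding X doubly_balanced_def by auto
  have "int p dvd \<bar>idet A * idet B\<bar>"
    using det by (auto simp del: dvd_abs_iff)
  then have "int p dvd idet A \<or> int p dvd idet B"
    using assms(4) by (simp add: prime_dvd_mult_iff)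
  then show "A \<in> Units M2 \<or> B \<in> Units M2"
  proof
    assume "int p dvd idet A"
    then show ?thesis
      using cofactor_of_prime_small[OF assms(4) det] Units_right_factor bal cop by blast
  next
    assume "int p dvd idet B"
    then show ?thesis
      using cofactor_of_prime_small[OF assms(4), of "idet B" "idet A"] det
        Units_left_factor bal cop by (metis mult.commute)
  qed
qed

end
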